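(* Let $\mathbf{w}_t=(\mathbf{x}_t,\mathbf{z}_t,\mathbf{y}_t)$, $t\ge 1$, be generated by ADM for the problem $\min_{\mathbf{x},\mathbf{z}} f(\mathbf{x})+g(\mathbf{z})$ s.t. $A\mathbf{x}+B\mathbf{z}=\mathbf{c}$, with penalty parameter $\rho>0$, started from $\mathbf{z}_0=\mathbf{0}$, $\mathbf{y}_0=\mathbf{0}$. Assume that $f,g$ are closed, proper and convex, that an optimal solution exists, and that the dual variables $\mathbf{y}$ (including the iterates $\mathbf y_t$) lie in a bounded set $\mathcal{Y}\subset\mathbb{R}^m$ with $\|\mathbf{y}\|_2\le D$ on $\mathcal{Y}$. Let $\Omega=\mathcal{X}\times\mathcal{Z}\times\mathcal{Y}$, $h(\mathbf{w})=f(\mathbf{x})+g(\mathbf{z})$ and $$F(\mathbf{w})=\begin{bmatrix}A^T\mathbf{y}\\ B^T\mathbf{y}\\ -(A\mathbf{x}+B\mathbf{z}-\mathbf{c})\end{bmatrix}\qquad\text{for }\mathbf{w}=(\mathbf{x},\mathbf{z},\mathbf{y}).$$ For $T\ge 1$ let $\bar{\mathbf{w}}_T=\frac1T\sum_{t=1}^T\mathbf{w}_t$. Then for all $\mathbf{w}=(\mathbf{x},\mathbf{z},\mathbf{y})\in\Omega$, $$h(\bar{\mathbf{w}}_T)-h(\mathbf{w})+\langle\bar{\mathbf{w}}_T-\mathbf{w},F(\bar{\mathbf{w}}_T)\rangle\le\frac{L}{T},\qquad L=\frac{\rho}{2}\|A\mathbf{x}-\mathbf{c}\|_2^2+\frac{1}{2\rho}\|\mathbf{y}\|_2^2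 .$$
   Context: Here $A\in\mathbb{R}^{m\times n_1}$, $B\in\mathbb{R}^{m\times n_2}$, $\mathbf{c}\in\mathbb{R}^m$, $f:\mathbb{R}^{n_1}\to\mathbb{R}\cup\{+\infty\}$, $g:\mathbb{R}^{n_2}\to\mathbb{R}\cup\{+\infty\}$. $\mathcal{X}\subset\mathbb{R}^{n_1}$ and $\mathcal{Z}\subset\mathbb{R}^{n_2}$ are the convex feasible sets for $\mathbf{x}$ and $\mathbf{z}$; the constraints $\mathbf{x}\in\mathcal{X}$, $\mathbf{z}\in\mathcal{Z}$ are encoded in $f$ and $g$ through indicator functions. ADM (alternating direction method of multipliers): for $t\ge 0$, given $(\mathbf{z}_t,\mathbf{y}_t)$, the iterates satisfy $$\mathbf{x}_{t+1}\in\operatorname{argmin}_{\mathbf{x}}\{f(\mathbf{x})+\langle\mathbf{y}_t,A\mathbf{x}+B\mathbf{z}_t-\mathbf{c}\rangle+\tfrac{\rho}{2}\|A\mathbf{x}+B\mathbf{z}_t-\mathbf{c}\|_2^2\},$$ $$\mathbf{z}_{t+1}\in\operatorname{argmin}_{\mathbf{z}}\{g(\mathbf{z})+\langle\mathbf{y}_t,A\mathbf{x}_{t+1}+B\mathbf{z}-\mathbf{c}\rangle+\tfrac{\rho}{2}\|A\mathbf{x}_{t+1}+B\mathbf{z}-\mathbf{c}\|_2^2\},$$ $$\mathbf{y}_{t+1}=\mathbf{y}_t+\rho(A\mathbf{x}_{t+1}+B\mathbf{z}_{t+1}-\mathbf{c}).$$ It is assumed that these minimizers exist. *)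

theory Defs
  imports "HOL-Analysis.Analysis"
begin

text \<open>
  Functions into the reals extended by \<open>+\<infinity>\<close> are rendered as \<^typ>\<open>ereal\<close>-valued functions;
  the value \<open>-\<infinity>\<close> is excluded by \<open>proper\<close>. The library's \<open>epigraph\<close> and \<open>convex_on\<close> only
  cover real-valued functions.
\<close>

definition ereal_epigraph :: "('a \<Rightarrow> ereal) \<Rightarrow> ('a \<times> real) set" where
  "ereal_epigraph f = {(x, r). f x \<le> ereal r}"

definition proper :: "('a \<Rightarrow> ereal) \<Rightarrow> bool" where
  "proper f \<longleftrightarrow> (\<forall>x. f x \<noteq> -\<infinity>) \<and> (\<exists>x. f x \<noteq> \<infinity>)"

definition closed_fun :: "('a::topological_space \<Rightarrow> ereal) \<Rightarrow> bool" where
  "closed_fun f \<longleftrightarrow> closed (ereal_epigraph f)"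

definition convex_fun :: "('a::real_vector \<Rightarrow> ereal) \<Rightarrow> bool" where
  "convex_fun f \<longleftrightarrow> convex (ereal_epigraph f)"

text \<open>The indicator function in the sense of convex analysis, with values \<open>0\<close> and \<open>+\<infinity>\<close>.\<close>

definition convex_indicator :: "'a set \<Rightarrow> 'a \<Rightarrow> ereal" where
  "convex_indicator S x = (if x \<in> S then 0 else \<infinity>)"

definition encodes_constraint :: "('a \<Rightarrow> ereal) \<Rightarrow> 'a set \<Rightarrow> bool" where
  "encodes_constraint f S \<longleftrightarrow>
    (\<exists>f0. (\<forall>x. f0 x \<noteq> -\<infinity>) \<and> (\<forall>x. f x = f0 x + convex_indicator S x))"

definition residual ::
  "real^'n1^'m \<Rightarrow> real^'n2^'m \<Rightarrow> real^'m \<Rightarrow> real^'n1 \<Rightarrow> real^'n2 \<Rightarrow> real^'m" where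
  "residual A B c x z = A *v x + B *v z - c"

text \<open>
  Since the constraint sets are encoded by infinite values, a point with infinite objective
  value is not admissible; hence the finiteness requirement.
\<close>

definition optimal_solution ::
  "real^'n1^'m \<Rightarrow> real^'n2^'m \<Rightarrow> real^'m \<Rightarrow> (real^'n1 \<Rightarrow> ereal) \<Rightarrow> (real^'n2 \<Rightarrow> ereal) \<Rightarrow>
    real^'n1 \<Rightarrow> real^'n2 \<Rightarrow> bool" where
  "optimal_solution A B c f g x z \<longleftrightarrow>
    f x + g z \<noteq> \<infinity> \<and>
    is_arg_min (\<lambda>(x, z). f x + g z) (\<lambda>(x, z). A *v x + B *v z = c) (x, z)"

text \<open>The value \<open>x 0\<close> is unconstrained: the iteration starts from \<open>z 0\<close> and \<open>y 0\<close>.\<close>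

definition adm_iterates ::
  "real^'n1^'m \<Rightarrow> real^'n2^'m \<Rightarrow> real^'m \<Rightarrow> (real^'n1 \<Rightarrow> ereal) \<Rightarrow> (real^'n2 \<Rightarrow> ereal) \<Rightarrow> real \<Rightarrow>
    (nat \<Rightarrow> real^'n1) \<Rightarrow> (nat \<Rightarrow> real^'n2) \<Rightarrow> (nat \<Rightarrow> real^'m) \<Rightarrow> bool" where
  "adm_iterates A B c f g \<rho> x z y \<longleftrightarrow> (\<forall>t.
    is_arg_min
      (\<lambda>u. f u + ereal (y t \<bullet> residual A B c u (z t)
                         + \<rho> / 2 * (norm (residual A B c u (z t)))\<^sup>2))
      (\<lambda>_. True) (x (Suc t)) \<and>
    is_arg_min
      (\<lambda>v. g v + ereal (y t \<bullet> residual A B c (x (Suc t)) v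
                         + \<rho> / 2 * (norm (residual A B c (x (Suc t)) v))\<^sup>2))
      (\<lambda>_. True) (z (Suc t)) \<and>
    y (Suc t) = y t + \<rho> *\<^sub>R residual A B c (x (Suc t)) (z (Suc t)))"

definition vi_objective ::
  "(real^'n1 \<Rightarrow> ereal) \<Rightarrow> (real^'n2 \<Rightarrow> ereal) \<Rightarrow> (real^'n1) \<times> (real^'n2) \<times> (real^'m) \<Rightarrow> ereal" where
  "vi_objective f g = (\<lambda>(x, z, y). f x + g z)"

definition vi_operator ::
  "real^'n1^'m \<Rightarrow> real^'n2^'m \<Rightarrow> real^'m \<Rightarrow>
    (real^'n1) \<times> (real^'n2) \<times> (real^'m) \<Rightarrow> (real^'n1) \<times> (real^'n2) \<times> (real^'m)" where
  "vi_operator A B c = (\<lambda>(x, z, y).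
    (transpose A *v y, transpose B *v y, - residual A B c x z))"

definition time_average :: "(nat \<Rightarrow> 'a::real_vector) \<Rightarrow> nat \<Rightarrow> 'a" where
  "time_average w T = (1 / real T) *\<^sub>R (\<Sum>t = 1..T. w t)"

end

theory Submission
  imports Defs
begin

text \<open>
  The first-order optimality conditions of the two subproblems, together with the dual update, bound
  \<open>h(w\<^sub>t) - h(w) + \<langle>w\<^sub>t - w, F(w\<^sub>t)\<rangle>\<close> by the decrease in one step of
  \<open>\<rho>/2 \<parallel>A x + B z\<^sub>t - c\<parallel>\<^sup>2 + \<parallel>y - y\<^sub>t\<parallel>\<^sup>2 / (2\<rho>)\<close>, so summing over the
  steps telescopes. Since the linear part of \<open>F\<close> is skew, \<open>\<langle>w\<^sub>t - w, F(w\<^sub>t)\<rangle> = \<langle>w\<^sub>t - w, F(w)\<rangle>\<close>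
  is affine in \<open>w\<^sub>t\<close>, and Jensen's inequality for \<open>f\<close> and \<open>g\<close> passes to the average.
\<close>

lemma convex_fun_segment:
  assumes "convex_fun f" "f p \<le> ereal a" "f u \<le> ereal b" "0 \<le> s" "s \<le> 1"
  shows "f ((1 - s) *\<^sub>R p + s *\<^sub>R u) \<le> ereal ((1 - s) * a + s * b)"
proof -
  have "(1 - s) *\<^sub>R (p, a) + s *\<^sub>R (u, b) \<in> ereal_epigraph f"
    using assms unfolding convex_fun_def
    by (intro convexD) (auto simp: ereal_epigraph_def)
  then show ?thesis by (simp add: ereal_epigraph_def)
qed

text \<open>Jensen's inequality read off the epigraph: the mean of the points
  \<open>(w t, a t)\<close> stays in this convex set. No case distinction on infinite values is
  needed.\<close>

lemma convex_fun_time_average: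
  assumes "convex_fun f" "\<And>t. t \<in> {1..T} \<Longrightarrow> f (w t) \<le> ereal (a t)" "T \<ge> 1"
  shows "f (time_average w T) \<le> ereal ((\<Sum>t = 1..T. a t) / real T)"
proof -
  have "(\<Sum>t = 1..T. (1 / real T) *\<^sub>R (w t, a t)) \<in> ereal_epigraph f"
    using assms unfolding convex_fun_def
    by (intro convex_sum) (auto simp: ereal_epigraph_def)
  moreover have "(\<Sum>t = 1..T. (1 / real T) *\<^sub>R (w t, a t))
      = (time_average w T, (\<Sum>t = 1..T. a t) / real T)"
    by (simp add: time_average_def prod_eq_iff fst_sum snd_sum scaleR_sum_right sum_divide_distrib)
  ultimately show ?thesis by (simp add: ereal_epigraph_def)
qed

text \<open>Letting \<open>s\<close> tend to 0 from the right discards the second-order term in the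
  variational argument below.\<close>

lemma nonneg_if_affine_nonneg:
  fixes k e :: real
  assumes "\<And>s. 0 < s \<Longrightarrow> s \<le> 1 \<Longrightarrow> 0 \<le> k + s * e"
  shows "0 \<le> k"
proof (rule tendsto_lowerbound)
  show "((\<lambda>s. k + s * e) \<longlongrightarrow> k) (at_right 0)"
    by (auto intro!: tendsto_eq_intros)
  show "\<forall>\<^sub>F s in at_right 0. 0 \<le> k + s * e"
    unfolding eventually_at_right_field using assms by (intro exI[of _ 1]) auto
qed simp

text \<open>Compare the minimizer with any point where \<open>f\<close> is finite; the added term is
  real everywhere.\<close>

lemma augmented_arg_min_finite:
  assumes "proper f" "is_arg_min (\<lambda>u. f u + ereal (\<phi> u)) (\<lambda>_. True) p"
  shows "\<exists>r. f p = ereal r"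
proof -
  obtain v where "f v \<noteq> \<infinity>" using assms(1) unfolding proper_def by blast
  moreover have "f p + ereal (\<phi> p) \<le> f v + ereal (\<phi> v)"
    using assms(2) by (simp add: is_arg_min_linorder)
  moreover have "f p \<noteq> -\<infinity>" using assms(1) unfolding proper_def by blast
  ultimately show ?thesis by (cases "f p") auto
qed

text \<open>First-order optimality without subdifferentials: compare \<open>p\<close> with the
  points of the segment towards \<open>u\<close>, use convexity for \<open>f\<close> and expand the
  smooth part, then let the step length \<open>s\<close> tend to 0.\<close>

lemma augmented_arg_min_optimality:
  fixes M :: "real^'n^'m" and d q :: "real^'m" and f :: "real^'n \<Rightarrow> ereal"
  assumes "convex_fun f"
    and min: "is_arg_min (\<lambda>u. f u + ereal (q \<bullet> (M *v u + d) + \<rho> / 2 * (norm (M *v u + d))\<^sup>2))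
      (\<lambda>_. True) p"
    and fp: "f p = ereal a" and fu: "f u = ereal b"
  shows "a - b + (M *v p - M *v u) \<bullet> (q + \<rho> *\<^sub>R (M *v p + d)) \<le> 0"
proof -
  define r where "r = M *v p + d"
  define v where "v = M *v u - M *v p"
  have "0 \<le> (b - a + v \<bullet> (q + \<rho> *\<^sub>R r)) + s * (\<rho> / 2 * (v \<bullet> v))" if s: "0 < s" "s \<le> 1" for s
  proof -
    define w where "w = (1 - s) *\<^sub>R p + s *\<^sub>R u"
    have Mw: "M *v w + d = r + s *\<^sub>R v"
      by (simp add: w_def r_def v_def matrix_vector_right_distrib matrix_vector_mult_scaleR
          algebra_simps)
    have fw: "f w \<le> ereal ((1 - s) * a + s * b)"
      unfolding w_def using convex_fun_segment[OF assms(1), of p a u b s] fp fu s by simp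
    have "ereal (a + (q \<bullet> r + \<rho> / 2 * (norm r)\<^sup>2))
        \<le> f w + ereal (q \<bullet> (r + s *\<^sub>R v) + \<rho> / 2 * (norm (r + s *\<^sub>R v))\<^sup>2)"
      using min Mw by (simp add: is_arg_min_linorder fp flip: r_def) (metis Mw)
    also have "\<dots> \<le> ereal ((1 - s) * a + s * b)
        + ereal (q \<bullet> (r + s *\<^sub>R v) + \<rho> / 2 * (norm (r + s *\<^sub>R v))\<^sup>2)"
      using fw by (rule add_right_mono)
    \<comment> \<open>All terms of order zero in \<open>s\<close> cancel, so one factor
      \<open>s\<close> can be divided out.\<close>
    finally have "0 \<le> s * ((b - a + v \<bullet> (q + \<rho> *\<^sub>R r)) + s * (\<rho> / 2 * (v \<bullet> v)))"
      by (simp add: power2_norm_eq_inner inner_simps inner_commute algebra_simps)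
    then show ?thesis using s(1) by (simp add: zero_le_mult_iff)
  qed
  then have "0 \<le> b - a + v \<bullet> (q + \<rho> *\<^sub>R r)" by (rule nonneg_if_affine_nonneg)
  then show ?thesis by (simp add: r_def v_def inner_diff_left)
qed

lemma inner_vector_matrix_mult:
  fixes M :: "real^'n^'m"
  shows "u \<bullet> (v v* M) = (M *v u) \<bullet> v"
  by (metis dot_lmul_matrix inner_commute)

lemma vi_operator_skew:
  "(w - w') \<bullet> vi_operator A B c w = (w - w') \<bullet> vi_operator A B c w'"
proof -
  obtain x z y x' z' y' where w: "w = (x, z, y)" "w' = (x', z', y')" by (metis prod_cases3)
  show ?thesis
    unfolding w vi_operator_def residual_def
    by (simp add: inner_vector_matrix_mult inner_simps inner_commute algebra_simps)
qed

lemma inner_time_average_diff: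
  assumes "T \<ge> 1"
  shows "(time_average w T - v) \<bullet> F = (\<Sum>t = 1..T. (w t - v) \<bullet> F) / real T"
  using assms
  by (simp add: time_average_def inner_diff_left inner_sum_left sum_subtractf diff_divide_distrib)

lemma time_average_triple:
  "time_average (\<lambda>t. (xs t, zs t, ys t)) T
    = (time_average xs T, time_average zs T, time_average ys T)"
  by (simp add: time_average_def prod_eq_iff fst_sum snd_sum)

text \<open>In one step of the iteration, \<open>a\<close> and \<open>b\<close> stand for \<open>A x - c\<close> and \<open>A x\<^sub>t\<^sub>+\<^sub>1 - c\<close>,
  \<open>p\<close> and \<open>q\<close> for \<open>B z\<^sub>t\<close> and \<open>B z\<^sub>t\<^sub>+\<^sub>1\<close>.\<close>

lemma adm_energy_step:
  fixes a b p q y y0 :: "'a::real_inner"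
  assumes "\<rho> > 0" and y1: "y1 = y0 + \<rho> *\<^sub>R (b + q)"
  shows "\<rho> * ((a - b) \<bullet> (p - q)) - (y1 - y) \<bullet> (b + q)
    \<le> (\<rho> / 2 * (norm (a + p))\<^sup>2 + 1 / (2 * \<rho>) * (norm (y - y0))\<^sup>2)
      - (\<rho> / 2 * (norm (a + q))\<^sup>2 + 1 / (2 * \<rho>) * (norm (y - y1))\<^sup>2)"
proof -
  have "(norm (y - y1))\<^sup>2 = (norm (y - y0))\<^sup>2 - 2 * \<rho> * ((y - y0) \<bullet> (b + q)) + \<rho>\<^sup>2 * (norm (b + q))\<^sup>2"
    unfolding y1 power2_norm_eq_inner
    by (simp add: inner_simps inner_commute power2_eq_square algebra_simps)
  then have "1 / (2 * \<rho>) * (norm (y - y1))\<^sup>2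
      = 1 / (2 * \<rho>) * (norm (y - y0))\<^sup>2 - (y - y0) \<bullet> (b + q) + \<rho> / 2 * (norm (b + q))\<^sup>2"
    using assms(1) by (simp add: field_simps power2_eq_square)
  moreover have "(y1 - y) \<bullet> (b + q) = \<rho> * (norm (b + q))\<^sup>2 - (y - y0) \<bullet> (b + q)"
    unfolding y1 power2_norm_eq_inner by (simp add: inner_simps algebra_simps)
  \<comment> \<open>Polarization turns the cross term into squares; combined with the dual terms, it
    leaves exactly \<open>- \<rho> / 2 * (norm (b + p))\<^sup>2\<close> beyond the claimed
    decrease.\<close>
  moreover have "\<rho> * ((a - b) \<bullet> (p - q))
      = \<rho> / 2 * ((norm (a + p))\<^sup>2 - (norm (a + q))\<^sup>2 + (norm (b + q))\<^sup>2 - (norm (b + p))\<^sup>2)"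
    unfolding power2_norm_eq_inner by (simp add: inner_simps inner_commute algebra_simps)
  moreover have "0 \<le> \<rho> / 2 * (norm (b + p))\<^sup>2"
    using assms(1) by simp
  ultimately show ?thesis by (simp add: algebra_simps)
qed

text \<open>Adding the optimality conditions of the two subproblems yields all of the left-hand side
  except one cross term and the residual term; \<open>adm_energy_step\<close> bounds these
  two.\<close>

lemma adm_step:
  assumes "\<rho> > 0" "convex_fun f" "convex_fun g"
    and adm: "adm_iterates A B c f g \<rho> xs zs ys"
    and f1: "f (xs (Suc t)) = ereal a1" and g1: "g (zs (Suc t)) = ereal b1"
    and f: "f x = ereal a" and g: "g z = ereal b"
  shows "a1 + b1 - (a + b)
      + ((xs (Suc t), zs (Suc t), ys (Suc t)) - (x, z, y))
          \<bullet> vi_operator A B c (xs (Suc t), zs (Suc t), ys (Suc t))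
    \<le> (\<rho> / 2 * (norm (A *v x - c + B *v zs t))\<^sup>2 + 1 / (2 * \<rho>) * (norm (y - ys t))\<^sup>2)
      - (\<rho> / 2 * (norm (A *v x - c + B *v zs (Suc t)))\<^sup>2
          + 1 / (2 * \<rho>) * (norm (y - ys (Suc t)))\<^sup>2)"
proof -
  let ?x = "xs (Suc t)" and ?z = "zs (Suc t)" and ?y = "ys (Suc t)"
  note step = adm[unfolded adm_iterates_def, rule_format, of t]
  have y: "?y = ys t + \<rho> *\<^sub>R ((A *v ?x - c) + B *v ?z)"
    using step unfolding residual_def by (simp add: algebra_simps)
  have rx: "residual A B c u (zs t) = A *v u + (B *v zs t - c)" for u
    by (simp add: residual_def)
  have rz: "residual A B c ?x v = B *v v + (A *v ?x - c)" for v
    by (simp add: residual_def)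
  have "a1 - a + (A *v ?x - A *v x) \<bullet> (ys t + \<rho> *\<^sub>R (A *v ?x + (B *v zs t - c))) \<le> 0"
    by (rule augmented_arg_min_optimality[OF assms(2) step[THEN conjunct1, unfolded rx] f1 f])
  \<comment> \<open>The first subproblem sees the old \<open>zs t\<close>, the dual update the new
    \<open>zs (Suc t)\<close>; the mismatch is the source of the cross term.\<close>
  moreover have "ys t + \<rho> *\<^sub>R (A *v ?x + (B *v zs t - c)) = ?y + \<rho> *\<^sub>R (B *v zs t - B *v ?z)"
    by (simp add: y algebra_simps)
  ultimately have x_opt: "a1 - a + (A *v ?x - A *v x) \<bullet> (?y + \<rho> *\<^sub>R (B *v zs t - B *v ?z)) \<le> 0"
    by simp
  have "b1 - b + (B *v ?z - B *v z) \<bullet> (ys t + \<rho> *\<^sub>R (B *v ?z + (A *v ?x - c))) \<le> 0"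
    by (rule augmented_arg_min_optimality[OF assms(3) step[THEN conjunct2, THEN conjunct1, unfolded rz] g1 g])
  \<comment> \<open>Here the gradient is exactly the updated multiplier, so no cross term
    arises.\<close>
  then have z_opt: "b1 - b + (B *v ?z - B *v z) \<bullet> ?y \<le> 0"
    by (simp add: y add.commute)
  have "((?x, ?z, ?y) - (x, z, y)) \<bullet> vi_operator A B c (?x, ?z, ?y)
      = (A *v ?x - A *v x) \<bullet> ?y + (B *v ?z - B *v z) \<bullet> ?y
        - (?y - y) \<bullet> ((A *v ?x - c) + B *v ?z)"
    unfolding vi_operator_def residual_def
    by (simp add: inner_vector_matrix_mult inner_simps algebra_simps)
  moreover have "(A *v ?x - A *v x) \<bullet> (?y + \<rho> *\<^sub>R (B *v zs t - B *v ?z))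
      = (A *v ?x - A *v x) \<bullet> ?y
        - \<rho> * (((A *v x - c) - (A *v ?x - c)) \<bullet> (B *v zs t - B *v ?z))"
    by (simp add: inner_simps algebra_simps)
  ultimately show ?thesis
    using adm_energy_step[OF assms(1) y, of "A *v x - c" "B *v zs t" y] x_opt z_opt by linarith
qed

theorem theorem3:
  fixes A :: "real^'n1^'m" and B :: "real^'n2^'m" and c :: "real^'m"
    and f :: "real^'n1 \<Rightarrow> ereal" and g :: "real^'n2 \<Rightarrow> ereal"
    and X :: "(real^'n1) set" and Z :: "(real^'n2) set" and Y :: "(real^'m) set"
    and \<rho> D :: real
    and xs :: "nat \<Rightarrow> real^'n1" and zs :: "nat \<Rightarrow> real^'n2" and ys :: "nat \<Rightarrow> real^'m"
    and T :: nat
  assumes "\<rho> > 0"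
    and "closed_fun f" and "proper f" and "convex_fun f"
    and "closed_fun g" and "proper g" and "convex_fun g"
    and "convex X" and "convex Z"
    and "encodes_constraint f X" and "encodes_constraint g Z"
    and "\<exists>x z. optimal_solution A B c f g x z"
    and "adm_iterates A B c f g \<rho> xs zs ys"
    and "zs 0 = 0" and "ys 0 = 0"
    and "bounded Y" and "\<forall>y\<in>Y. norm y \<le> D"
    and "\<forall>t\<ge>1. ys t \<in> Y"
    and "T \<ge> 1"
  shows "\<forall>(x, z, y) \<in> X \<times> Z \<times> Y.
    (let w = (x, z, y);
         wbar = time_average (\<lambda>t. (xs t, zs t, ys t)) T;
         h = vi_objective f g;
         F = vi_operator A B c;
         L = \<rho> / 2 * (norm (A *v x - c))\<^sup>2 + 1 / (2 * \<rho>) * (norm y)\<^sup>2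
     in h wbar - h w + ereal ((wbar - w) \<bullet> F wbar) \<le> ereal (L / real T))"
proof (intro ballI, clarify)
  fix x :: "real^'n1" and z :: "real^'n2" and y :: "real^'m"
  let ?w = "\<lambda>t. (xs t, zs t, ys t)"
  let ?F = "vi_operator A B c"
  let ?L = "\<rho> / 2 * (norm (A *v x - c))\<^sup>2 + 1 / (2 * \<rho>) * (norm y)\<^sup>2"
  let ?in = "(time_average ?w T - (x, z, y)) \<bullet> ?F (time_average ?w T)"
  define h where "h t = real_of_ereal (f (xs t))" for t
  define k where "k t = real_of_ereal (g (zs t))" for t
  \<comment> \<open>Only iterates of positive index are minimizers; the values at
    \<open>xs 0\<close> and \<open>zs 0\<close> may be infinite.\<close>
  have fin: "f (xs (Suc t)) = ereal (h (Suc t))" "g (zs (Suc t)) = ereal (k (Suc t))" for t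
  proof -
    note adm = \<open>adm_iterates A B c f g \<rho> xs zs ys\<close>[unfolded adm_iterates_def, rule_format, of t]
    show "f (xs (Suc t)) = ereal (h (Suc t))"
      using augmented_arg_min_finite[OF \<open>proper f\<close> adm[THEN conjunct1]] by (auto simp: h_def)
    show "g (zs (Suc t)) = ereal (k (Suc t))"
      using augmented_arg_min_finite[OF \<open>proper g\<close> adm[THEN conjunct2, THEN conjunct1]]
      by (auto simp: k_def)
  qed
  have fin': "f (xs t) = ereal (h t)" "g (zs t) = ereal (k t)" if "t \<in> {1..T}" for t
    using fin[of "t - 1"] that by simp_all
  have fbar: "f (time_average xs T) \<le> ereal ((\<Sum>t = 1..T. h t) / real T)"
    using fin' \<open>T \<ge> 1\<close> by (intro convex_fun_time_average[OF \<open>convex_fun f\<close>]) auto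
  have gbar: "g (time_average zs T) \<le> ereal ((\<Sum>t = 1..T. k t) / real T)"
    using fin' \<open>T \<ge> 1\<close> by (intro convex_fun_time_average[OF \<open>convex_fun g\<close>]) auto
  have "f (time_average xs T) \<noteq> -\<infinity>" "g (time_average zs T) \<noteq> -\<infinity>"
    using \<open>proper f\<close> \<open>proper g\<close> unfolding proper_def by blast+
  then obtain p q where pq: "f (time_average xs T) = ereal p" "g (time_average zs T) = ereal q"
    using fbar gbar by (metis ereal_infty_less_eq(1) ereal.distinct(1) ereal_cases)
  have nm: "f x \<noteq> -\<infinity>" "g z \<noteq> -\<infinity>"
    using \<open>proper f\<close> \<open>proper g\<close> unfolding proper_def by blast+
  have goal: "ereal p + ereal q - (f x + g z) + ereal ?in \<le> ereal (?L / real T)"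
  proof (cases "f x = \<infinity> \<or> g z = \<infinity>")
    case True
    \<comment> \<open>The subtracted objective is infinite, so the left-hand side is
      \<open>-\<infinity>\<close>.\<close>
    then show ?thesis using nm by auto
  next
    case False
    then obtain a b where ab: "f x = ereal a" "g z = ereal b" using nm by (metis ereal_cases)
    let ?V = "\<lambda>t. \<rho> / 2 * (norm (A *v x - c + B *v zs t))\<^sup>2 + 1 / (2 * \<rho>) * (norm (y - ys t))\<^sup>2"
    have "(\<Sum>t = 1..T. h t + k t - (a + b) + (?w t - (x, z, y)) \<bullet> ?F (x, z, y))
        = (\<Sum>t<T. h (Suc t) + k (Suc t) - (a + b) + (?w (Suc t) - (x, z, y)) \<bullet> ?F (?w (Suc t)))"
      \<comment> \<open>Skewness moves the operator to the fixed point \<open>(x, z, y)\<close>,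
        making the summand affine in the iterate.\<close>
      unfolding vi_operator_skew[of _ "(x, z, y)"]
      by (rule sum.reindex_bij_witness[of _ Suc "\<lambda>t. t - 1"]) auto
    also have "\<dots> \<le> (\<Sum>t<T. ?V t - ?V (Suc t))"
      using adm_step[OF \<open>\<rho> > 0\<close> \<open>convex_fun f\<close> \<open>convex_fun g\<close>
          \<open>adm_iterates A B c f g \<rho> xs zs ys\<close> fin ab]
      by (intro sum_mono)
    also have "\<dots> = ?V 0 - ?V T" by (rule sum_lessThan_telescope')
    also have "\<dots> \<le> ?V 0"
    proof -
      have "0 \<le> ?V T" using \<open>\<rho> > 0\<close> by (intro add_nonneg_nonneg mult_nonneg_nonneg) auto
      then show ?thesis by linarith
    qed
    \<comment> \<open>The zero start removes \<open>B *v zs 0\<close> and \<open>ys 0\<close> from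
      the initial energy.\<close>
    also have "\<dots> = ?L" using \<open>zs 0 = 0\<close> \<open>ys 0 = 0\<close> by simp
    finally have "(\<Sum>t = 1..T. h t + k t - (a + b) + (?w t - (x, z, y)) \<bullet> ?F (x, z, y)) / real T
        \<le> ?L / real T"
      by (rule divide_right_mono) simp
    \<comment> \<open>The same skewness, now at the average, lets the inner product be averaged term
      by term.\<close>
    moreover have "?in = (\<Sum>t = 1..T. (?w t - (x, z, y)) \<bullet> ?F (x, z, y)) / real T"
      unfolding vi_operator_skew[of _ "(x, z, y)"] by (rule inner_time_average_diff[OF \<open>T \<ge> 1\<close>])
    moreover have "(\<Sum>t = 1..T. h t + k t - (a + b) + (?w t - (x, z, y)) \<bullet> ?F (x, z, y)) / real T
        = (\<Sum>t = 1..T. h t) / real T + (\<Sum>t = 1..T. k t) / real T - (a + b)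
          + (\<Sum>t = 1..T. (?w t - (x, z, y)) \<bullet> ?F (x, z, y)) / real T"
      using \<open>T \<ge> 1\<close> unfolding sum.distrib sum_subtractf by (simp add: field_simps)
    moreover have "p \<le> (\<Sum>t = 1..T. h t) / real T" "q \<le> (\<Sum>t = 1..T. k t) / real T"
      using fbar gbar pq by simp_all
    ultimately have "p + q - (a + b) + ?in \<le> ?L / real T" by linarith
    then show ?thesis by (simp add: ab)
  qed
  have "vi_objective f g (time_average ?w T) = ereal p + ereal q" "vi_objective f g (x, z, y) = f x + g z"
    by (simp_all add: vi_objective_def time_average_triple pq)
  with goal show "let w = (x, z, y); wbar = time_average ?w T; h = vi_objective f g; F = ?F; L = ?L
     in h wbar - h w + ereal ((wbar - w) \<bullet> F wbar) \<le> ereal (L / real T)"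
    by (simp only: Let_def)
qed

end
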